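(* Let $\mathcal N\subseteq\mathcal B(\mathcal H)$ be a von Neumann algebra and $\mathcal S\subseteq\mathcal B(\mathcal H)$ a finite set such that the commutant $\mathcal S'$ is a von Neumann algebra and there is a normal conditional expectation $E_{\mathrm{fix}}:\mathcal N\to\mathcal S'\cap\mathcal N$ (fixed). For every channel $\Phi:\mathcal N\to\mathcal N$ with $\Phi\circ E_{\mathrm{fix}}=E_{\mathrm{fix}}$, $$\mathrm{Lip}_{\mathcal S}(\Phi)\le2\sup_{s\in\mathcal S}\|s\|_{op}\,\mathrm{Cost}_{\mathcal S}(E_{\mathrm{fix}}),\qquad \mathrm{Lip}^{cb}_{\mathcal S}(\Phi)\le2\sup_{s\in\mathcal S}\|s\|_{op}\,\mathrm{Cost}^{cb}_{\mathcal S}(E_{\mathrm{fix}}).$$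
   Context: A channel is a normal unital completely positive map $\Phi:\mathcal N\to\mathcal N$; $\Phi^{(n)}=\mathrm{id}_{\mathbb M_n}\otimes\Phi$. For $x\in\mathbb M_n(\mathcal N)$ put $|||x|||_{\mathcal S^{(n)}}=\sup_{s\in\mathcal S}\|[\mathbb I_n\otimes s,x]\|_{op}$. Then $$\mathrm{Cost}_{\mathcal S}^{cb}(\Phi)=\sup_{n\ge1}\sup\{\|\Phi^{(n)}(x)-x\|_{op}: x=x^*\in\mathbb M_n(\mathcal N),\ |||x|||_{\mathcal S^{(n)}}\le1\},$$ $$\mathrm{Lip}_{\mathcal S}^{cb}(\Phi)=\sup_{n\ge1}\sup\{|||\Phi^{(n)}(x)|||_{\mathcal S^{(n)}}: x=x^*\in\mathbb M_n(\mathcal N),\ |||x|||_{\mathcal S^{(n)}}\le1\},$$ and $\mathrm{Cost}_{\mathcal S}(\Phi)$, $\mathrm{Lip}_{\mathcal S}(\Phi)$ are the same with only $n=1$. *)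

theory Defs
  imports "HOL-Analysis.Analysis"
begin

section \<open>Complex Hilbert spaces and bounded operators\<close>

text \<open>
  A complex inner product space is a real one (so that norm, topology and bounded linear
  maps are those of the library) with a complex scalar multiplication and a sesquilinear form,
  antilinear in the first argument, whose real part is the real inner product.
\<close>

class complex_inner = real_inner +
  fixes scaleC :: "complex \<Rightarrow> 'a \<Rightarrow> 'a" (infixr "*\<^sub>C" 75)
    and cinner :: "'a \<Rightarrow> 'a \<Rightarrow> complex"
  assumes scaleC_add_right: "c *\<^sub>C (x + y) = c *\<^sub>C x + c *\<^sub>C y"
    and scaleC_add_left: "(c + d) *\<^sub>C x = c *\<^sub>C x + d *\<^sub>C x"
    and scaleC_scaleC: "c *\<^sub>C d *\<^sub>C x = (c * d) *\<^sub>C x"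
    and scaleR_scaleC: "r *\<^sub>R x = complex_of_real r *\<^sub>C x"
    and cinner_commute: "cinner x y = cnj (cinner y x)"
    and cinner_add_right: "cinner x (y + z) = cinner x y + cinner x z"
    and cinner_scaleC_right: "cinner x (c *\<^sub>C y) = c * cinner x y"
    and inner_eq_Re_cinner: "inner x y = Re (cinner x y)"

class complex_hilbert_space = complex_inner + complete_space

lemma cinner_scaleC_left: "cinner (c *\<^sub>C x) y = cnj c * cinner x y"
  by (metis cinner_commute cinner_scaleC_right complex_cnj_mult)

lemma norm_scaleC: "norm (c *\<^sub>C (x :: 'a::complex_inner)) = norm c * norm x"
proof -
  have "cinner (c *\<^sub>C x) (c *\<^sub>C x) = complex_of_real ((norm c)\<^sup>2) * cinner x x"
    by (simp only: cinner_scaleC_left cinner_scaleC_right complex_norm_square)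
       (simp add: mult_ac)
  then have "inner (c *\<^sub>C x) (c *\<^sub>C x) = (norm c)\<^sup>2 * inner x x"
    by (simp add: inner_eq_Re_cinner)
  then show ?thesis
    by (simp add: norm_eq_sqrt_inner real_sqrt_mult)
qed

lemma bounded_linear_scaleC: "bounded_linear ((*\<^sub>C) c :: 'a::complex_inner \<Rightarrow> 'a)"
proof (rule bounded_linear_intro)
  fix x y :: 'a and r :: real
  show "c *\<^sub>C (x + y) = c *\<^sub>C x + c *\<^sub>C y"
    by (rule scaleC_add_right)
  show "c *\<^sub>C (r *\<^sub>R x) = r *\<^sub>R (c *\<^sub>C x)"
    by (simp add: scaleR_scaleC scaleC_scaleC mult.commute)
  show "norm (c *\<^sub>C x) \<le> norm x * norm c"
    by (simp add: norm_scaleC mult.commute)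
qed

lift_definition cscalar :: "complex \<Rightarrow> 'h \<Rightarrow>\<^sub>L 'h::complex_inner"
  is "(*\<^sub>C)" by (rule bounded_linear_scaleC)

text \<open>
  The library type of bounded operators consists of the real-linear ones; \<open>bounded_ops\<close> singles
  out the complex-linear ones. The operator norm is the same, so it is the library norm.
\<close>

definition bounded_ops :: "('h \<Rightarrow>\<^sub>L 'h::complex_inner) set" where
  "bounded_ops = {T :: 'h \<Rightarrow>\<^sub>L 'h. \<forall>c x. T (c *\<^sub>C x) = c *\<^sub>C T x}"

definition is_adjoint :: "('h \<Rightarrow>\<^sub>L 'h::complex_inner) \<Rightarrow> ('h \<Rightarrow>\<^sub>L 'h) \<Rightarrow> bool" where
  "is_adjoint T T' \<longleftrightarrow> (\<forall>x y. cinner (T x) y = cinner x (T' y))"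

definition commutant :: "('h \<Rightarrow>\<^sub>L 'h::complex_inner) set \<Rightarrow> ('h \<Rightarrow>\<^sub>L 'h) set" where
  "commutant S = {T \<in> bounded_ops. \<forall>s\<in>S. T o\<^sub>L s = s o\<^sub>L T}"


section \<open>Von Neumann algebras and normal maps\<close>

definition initial_topology :: "'b set \<Rightarrow> ('b \<Rightarrow> complex) set \<Rightarrow> 'b topology" where
  "initial_topology B F = topology_generated_by {{T \<in> B. f T \<in> U} | f U. f \<in> F \<and> open U}"

definition wot :: "('h \<Rightarrow>\<^sub>L 'h::complex_hilbert_space) topology" where
  "wot = initial_topology bounded_ops {\<lambda>T. cinner a (blinfun_apply T b) | a b. True}"

definition ultraweak :: "('h \<Rightarrow>\<^sub>L 'h::complex_hilbert_space) topology" where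
  "ultraweak = initial_topology bounded_ops
     {\<lambda>T. \<Sum>k. cinner (a k) (blinfun_apply T (b k)) | a b :: nat \<Rightarrow> 'h.
        summable (\<lambda>k. (norm (a k))\<^sup>2) \<and> summable (\<lambda>k. (norm (b k))\<^sup>2)}"

definition von_neumann_algebra :: "('h \<Rightarrow>\<^sub>L 'h::complex_hilbert_space) set \<Rightarrow> bool" where
  "von_neumann_algebra N \<longleftrightarrow>
     N \<subseteq> bounded_ops \<and>
     id_blinfun \<in> N \<and>
     (\<forall>x\<in>N. \<forall>y\<in>N. x + y \<in> N) \<and>
     (\<forall>c. \<forall>x\<in>N. cscalar c o\<^sub>L x \<in> N) \<and>
     (\<forall>x\<in>N. \<forall>y\<in>N. x o\<^sub>L y \<in> N) \<and>
     (\<forall>x\<in>N. \<exists>y\<in>N. is_adjoint x y) \<and>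
     closedin wot N"

text \<open>Normality is continuity for the ultraweak (sigma-weak) topologies.\<close>

definition normal_map ::
  "('h \<Rightarrow>\<^sub>L 'h::complex_hilbert_space) set \<Rightarrow> ('h \<Rightarrow>\<^sub>L 'h) set \<Rightarrow>
     (('h \<Rightarrow>\<^sub>L 'h) \<Rightarrow> ('h \<Rightarrow>\<^sub>L 'h)) \<Rightarrow> bool" where
  "normal_map N M \<Phi> \<longleftrightarrow>
     continuous_map (subtopology ultraweak N) (subtopology ultraweak M) \<Phi>"

definition linear_map_on ::
  "('h \<Rightarrow>\<^sub>L 'h::complex_hilbert_space) set \<Rightarrow> (('h \<Rightarrow>\<^sub>L 'h) \<Rightarrow> ('h \<Rightarrow>\<^sub>L 'h)) \<Rightarrow> bool" where
  "linear_map_on N \<Phi> \<longleftrightarrow>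
     (\<forall>x\<in>N. \<forall>y\<in>N. \<Phi> (x + y) = \<Phi> x + \<Phi> y) \<and>
     (\<forall>c. \<forall>x\<in>N. \<Phi> (cscalar c o\<^sub>L x) = cscalar c o\<^sub>L \<Phi> x)"


section \<open>Matrix amplifications\<close>

text \<open>
  An element of \<open>M\<^sub>n(N)\<close> is a function of two indices, of which only the values at indices
  below \<open>n\<close> matter; it acts on \<open>H\<^sup>n\<close>, whose elements are functions of one index below \<open>n\<close>.
\<close>

type_synonym 'h opmat = "nat \<Rightarrow> nat \<Rightarrow> 'h \<Rightarrow>\<^sub>L 'h"

definition matrices :: "nat \<Rightarrow> ('h \<Rightarrow>\<^sub>L 'h::complex_hilbert_space) set \<Rightarrow> 'h opmat set" where
  "matrices n N = {x. \<forall>i<n. \<forall>j<n. x i j \<in> N}"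

definition mat_apply ::
  "nat \<Rightarrow> 'h::complex_hilbert_space opmat \<Rightarrow> (nat \<Rightarrow> 'h) \<Rightarrow> (nat \<Rightarrow> 'h)" where
  "mat_apply n x v = (\<lambda>i. \<Sum>j<n. x i j (v j))"

definition vec_norm :: "nat \<Rightarrow> (nat \<Rightarrow> 'h::complex_hilbert_space) \<Rightarrow> real" where
  "vec_norm n v = sqrt (\<Sum>i<n. (norm (v i))\<^sup>2)"

definition vec_cinner ::
  "nat \<Rightarrow> (nat \<Rightarrow> 'h::complex_hilbert_space) \<Rightarrow> (nat \<Rightarrow> 'h) \<Rightarrow> complex" where
  "vec_cinner n v w = (\<Sum>i<n. cinner (v i) (w i))"

definition mat_norm :: "nat \<Rightarrow> 'h::complex_hilbert_space opmat \<Rightarrow> ennreal" where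
  "mat_norm n x = (SUP v\<in>{v. vec_norm n v \<le> 1}. ennreal (vec_norm n (mat_apply n x v)))"

definition mat_selfadjoint :: "nat \<Rightarrow> 'h::complex_hilbert_space opmat \<Rightarrow> bool" where
  "mat_selfadjoint n x \<longleftrightarrow> (\<forall>i<n. \<forall>j<n. is_adjoint (x i j) (x j i))"

definition mat_positive :: "nat \<Rightarrow> 'h::complex_hilbert_space opmat \<Rightarrow> bool" where
  "mat_positive n x \<longleftrightarrow>
     (\<forall>v. vec_cinner n v (mat_apply n x v) \<in> \<real> \<and> 0 \<le> Re (vec_cinner n v (mat_apply n x v)))"

definition mat_diag :: "('h \<Rightarrow>\<^sub>L 'h::complex_hilbert_space) \<Rightarrow> 'h opmat" where
  "mat_diag s = (\<lambda>i j. if i = j then s else 0)"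

definition mat_mult ::
  "nat \<Rightarrow> 'h::complex_hilbert_space opmat \<Rightarrow> 'h opmat \<Rightarrow> 'h opmat" where
  "mat_mult n x y = (\<lambda>i j. \<Sum>k<n. x i k o\<^sub>L y k j)"

definition mat_commutator ::
  "nat \<Rightarrow> 'h::complex_hilbert_space opmat \<Rightarrow> 'h opmat \<Rightarrow> 'h opmat" where
  "mat_commutator n x y = (\<lambda>i j. mat_mult n x y i j - mat_mult n y x i j)"

definition amplify ::
  "(('h \<Rightarrow>\<^sub>L 'h) \<Rightarrow> ('h \<Rightarrow>\<^sub>L 'h)) \<Rightarrow> 'h::complex_hilbert_space opmat \<Rightarrow> 'h opmat" where
  "amplify \<Phi> x = (\<lambda>i j. \<Phi> (x i j))"

lemma mat_norm_1: "mat_norm 1 x = ennreal (norm (x 0 0))"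
proof -
  let ?T = "x 0 0"
  have v: "vec_norm 1 v = norm (v 0)" for v :: "nat \<Rightarrow> 'a"
    by (simp add: vec_norm_def)
  have eq: "mat_norm 1 x = (SUP v\<in>{v :: nat \<Rightarrow> 'a. norm (v 0) \<le> 1}. ennreal (norm (?T (v 0))))"
    unfolding mat_norm_def v mat_apply_def by simp
  show ?thesis
  proof (rule antisym)
    show "mat_norm 1 x \<le> ennreal (norm ?T)"
      unfolding eq
    proof (rule SUP_least)
      fix v :: "nat \<Rightarrow> 'a" assume "v \<in> {v. norm (v 0) \<le> 1}"
      then have "norm ?T * norm (v 0) \<le> norm ?T"
        by (simp add: mult_left_le)
      then show "ennreal (norm (?T (v 0))) \<le> ennreal (norm ?T)"
        using norm_blinfun[of ?T "v 0"] by (intro ennreal_leI) linarith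
    qed
    have le: "ennreal (norm (?T a)) \<le> mat_norm 1 x" if "norm a \<le> 1" for a
      unfolding eq by (rule SUP_upper2[of "\<lambda>_. a"]) (use that in auto)
    show "ennreal (norm ?T) \<le> mat_norm 1 x"
    proof (cases "mat_norm 1 x")
      case (real m)
      have "norm ?T \<le> m"
      proof (rule norm_blinfun_bound[OF real(1)])
        fix a
        show "norm (?T a) \<le> m * norm a"
        proof (cases "a = 0")
          case False
          have "ennreal (norm (?T (a /\<^sub>R norm a))) \<le> ennreal m"
            using le[of "a /\<^sub>R norm a"] False real(2) by simp
          then have "norm (?T (a /\<^sub>R norm a)) \<le> m"
            using real(1) by (simp add: ennreal_le_iff)
          then show ?thesis
            using False by (simp add: blinfun.scaleR_right field_simps)
        qed simp
      qed
      then show ?thesis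
        using real by (simp add: ennreal_leI)
    qed simp
  qed
qed


section \<open>Channels and conditional expectations\<close>

definition completely_positive_on ::
  "('h \<Rightarrow>\<^sub>L 'h::complex_hilbert_space) set \<Rightarrow> (('h \<Rightarrow>\<^sub>L 'h) \<Rightarrow> ('h \<Rightarrow>\<^sub>L 'h)) \<Rightarrow> bool" where
  "completely_positive_on N \<Phi> \<longleftrightarrow>
     (\<forall>n\<ge>1. \<forall>x\<in>matrices n N. mat_positive n x \<longrightarrow> mat_positive n (amplify \<Phi> x))"

definition channel ::
  "('h \<Rightarrow>\<^sub>L 'h::complex_hilbert_space) set \<Rightarrow> (('h \<Rightarrow>\<^sub>L 'h) \<Rightarrow> ('h \<Rightarrow>\<^sub>L 'h)) \<Rightarrow> bool" where
  "channel N \<Phi> \<longleftrightarrow>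
     \<Phi> \<in> N \<rightarrow> N \<and> linear_map_on N \<Phi> \<and> \<Phi> id_blinfun = id_blinfun \<and>
     completely_positive_on N \<Phi> \<and> normal_map N N \<Phi>"

definition positive_op :: "('h \<Rightarrow>\<^sub>L 'h::complex_hilbert_space) \<Rightarrow> bool" where
  "positive_op T \<longleftrightarrow> (\<forall>v. cinner v (T v) \<in> \<real> \<and> 0 \<le> Re (cinner v (T v)))"

definition conditional_expectation ::
  "('h \<Rightarrow>\<^sub>L 'h::complex_hilbert_space) set \<Rightarrow> ('h \<Rightarrow>\<^sub>L 'h) set \<Rightarrow>
     (('h \<Rightarrow>\<^sub>L 'h) \<Rightarrow> ('h \<Rightarrow>\<^sub>L 'h)) \<Rightarrow> bool" where
  "conditional_expectation N M E \<longleftrightarrow>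
     M \<subseteq> N \<and> E \<in> N \<rightarrow> M \<and> linear_map_on N E \<and>
     (\<forall>x\<in>N. positive_op x \<longrightarrow> positive_op (E x)) \<and>
     (\<forall>x\<in>M. E x = x) \<and>
     (\<forall>a\<in>M. \<forall>b\<in>M. \<forall>x\<in>N. E (a o\<^sub>L x o\<^sub>L b) = a o\<^sub>L E x o\<^sub>L b)"


section \<open>Lipschitz constants and transport costs\<close>

text \<open>
  Suprema are taken in the extended nonnegative reals, since the cost may be infinite; the
  supremum of the empty set is \<open>0\<close>.
\<close>

definition lip_seminorm ::
  "nat \<Rightarrow> ('h \<Rightarrow>\<^sub>L 'h::complex_hilbert_space) set \<Rightarrow> 'h opmat \<Rightarrow> ennreal" where
  "lip_seminorm n S x = (SUP s\<in>S. mat_norm n (mat_commutator n (mat_diag s) x))"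

definition lip_ball ::
  "nat \<Rightarrow> ('h \<Rightarrow>\<^sub>L 'h::complex_hilbert_space) set \<Rightarrow> ('h \<Rightarrow>\<^sub>L 'h) set \<Rightarrow> 'h opmat set" where
  "lip_ball n S N = {x \<in> matrices n N. mat_selfadjoint n x \<and> lip_seminorm n S x \<le> 1}"

definition Cost_level ::
  "nat \<Rightarrow> ('h \<Rightarrow>\<^sub>L 'h::complex_hilbert_space) set \<Rightarrow> ('h \<Rightarrow>\<^sub>L 'h) set \<Rightarrow>
     (('h \<Rightarrow>\<^sub>L 'h) \<Rightarrow> ('h \<Rightarrow>\<^sub>L 'h)) \<Rightarrow> ennreal" where
  "Cost_level n S N \<Phi> =
     (SUP x\<in>lip_ball n S N. mat_norm n (\<lambda>i j. amplify \<Phi> x i j - x i j))"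

definition Lip_level ::
  "nat \<Rightarrow> ('h \<Rightarrow>\<^sub>L 'h::complex_hilbert_space) set \<Rightarrow> ('h \<Rightarrow>\<^sub>L 'h) set \<Rightarrow>
     (('h \<Rightarrow>\<^sub>L 'h) \<Rightarrow> ('h \<Rightarrow>\<^sub>L 'h)) \<Rightarrow> ennreal" where
  "Lip_level n S N \<Phi> = (SUP x\<in>lip_ball n S N. lip_seminorm n S (amplify \<Phi> x))"

definition Cost ::
  "('h \<Rightarrow>\<^sub>L 'h::complex_hilbert_space) set \<Rightarrow> ('h \<Rightarrow>\<^sub>L 'h) set \<Rightarrow>
     (('h \<Rightarrow>\<^sub>L 'h) \<Rightarrow> ('h \<Rightarrow>\<^sub>L 'h)) \<Rightarrow> ennreal" where
  "Cost S N \<Phi> = Cost_level 1 S N \<Phi>"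

definition Lip ::
  "('h \<Rightarrow>\<^sub>L 'h::complex_hilbert_space) set \<Rightarrow> ('h \<Rightarrow>\<^sub>L 'h) set \<Rightarrow>
     (('h \<Rightarrow>\<^sub>L 'h) \<Rightarrow> ('h \<Rightarrow>\<^sub>L 'h)) \<Rightarrow> ennreal" where
  "Lip S N \<Phi> = Lip_level 1 S N \<Phi>"

definition Cost_cb ::
  "('h \<Rightarrow>\<^sub>L 'h::complex_hilbert_space) set \<Rightarrow> ('h \<Rightarrow>\<^sub>L 'h) set \<Rightarrow>
     (('h \<Rightarrow>\<^sub>L 'h) \<Rightarrow> ('h \<Rightarrow>\<^sub>L 'h)) \<Rightarrow> ennreal" where
  "Cost_cb S N \<Phi> = (SUP n\<in>{1..}. Cost_level n S N \<Phi>)"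

definition Lip_cb ::
  "('h \<Rightarrow>\<^sub>L 'h::complex_hilbert_space) set \<Rightarrow> ('h \<Rightarrow>\<^sub>L 'h) set \<Rightarrow>
     (('h \<Rightarrow>\<^sub>L 'h) \<Rightarrow> ('h \<Rightarrow>\<^sub>L 'h)) \<Rightarrow> ennreal" where
  "Lip_cb S N \<Phi> = (SUP n\<in>{1..}. Lip_level n S N \<Phi>)"

end

theory Submission
  imports Defs
begin

text \<open>
  Since \<open>E x\<close> commutes with \<open>S\<close> and is fixed by \<open>\<Phi>\<close>, one has
  \<open>[s, \<Phi> x] = [s, \<Phi> (x - E x)]\<close>, whose norm is at most \<open>2 \<parallel>s\<parallel> \<parallel>\<Phi> (x - E x)\<parallel>\<close>. The element
  \<open>x - E x\<close> is selfadjoint because positive maps preserve adjoints, and a unital completely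
  positive map is contractive on selfadjoint matrices \<open>y\<close>: it preserves \<open>-c \<le> y \<le> c\<close>.
\<close>

section \<open>Adjoints and positive maps\<close>

lemma cscalar_apply [simp]: "blinfun_apply (cscalar c) v = c *\<^sub>C v"
  by transfer simp

text \<open>\<open>linear_map_on\<close> and \<open>von_neumann_algebra\<close> speak of complex
  scalars only. This is how real multiples, and with them negation and zero, are reached.\<close>

lemma cscalar_of_real: "cscalar (of_real r) o\<^sub>L x = r *\<^sub>R x"
  by (rule blinfun_eqI) (simp add: scaleR_scaleC blinfun.scaleR_left)

lemma cinner_add_left: "cinner (x + y) z = cinner x z + cinner y z"
  by (metis cinner_commute cinner_add_right complex_cnj_add)

lemma cinner_scaleR_right: "cinner x (r *\<^sub>R y) = of_real r * cinner x y"
  by (simp add: scaleR_scaleC cinner_scaleC_right)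

lemma cinner_scaleR_left: "cinner (r *\<^sub>R x) y = of_real r * cinner x y"
  by (simp add: scaleR_scaleC cinner_scaleC_left)

lemma cinner_minus_right: "cinner x (- y) = - cinner x y"
  using cinner_scaleR_right[of x "-1" y] by simp

lemma cinner_minus_left: "cinner (- x) y = - cinner x y"
  using cinner_scaleR_left[of "-1" x y] by simp

lemma cinner_diff_right: "cinner x (y - z) = cinner x y - cinner x z"
  using cinner_add_right[of x y "- z"] by (simp add: cinner_minus_right)

lemma cinner_diff_left: "cinner (x - y) z = cinner x z - cinner y z"
  using cinner_add_left[of x "- y" z] by (simp add: cinner_minus_left)

lemma cinner_zero_right [simp]: "cinner x 0 = 0"
  using cinner_scaleR_right[of x 0 0] by simp

lemma cinner_sum_right: "cinner x (sum f A) = (\<Sum>i\<in>A. cinner x (f i))"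
  by (induction A rule: infinite_finite_induct) (simp_all add: cinner_add_right)

lemma cinner_self: "cinner v v = of_real ((norm v)\<^sup>2)"
proof (rule complex_eqI)
  show "Re (cinner v v) = Re (of_real ((norm v)\<^sup>2))"
    by (simp add: power2_norm_eq_inner inner_eq_Re_cinner)
  show "Im (cinner v v) = Im (of_real ((norm v)\<^sup>2))"
    using arg_cong[OF cinner_commute[of v v], of Im] by simp
qed

lemma is_adjoint_sym: "is_adjoint T T' \<Longrightarrow> is_adjoint T' T"
  unfolding is_adjoint_def by (metis cinner_commute)

lemma is_adjoint_diff:
  "is_adjoint T T' \<Longrightarrow> is_adjoint U U' \<Longrightarrow> is_adjoint (T - U) (T' - U')"
  by (simp add: is_adjoint_def blinfun.diff_left cinner_diff_left cinner_diff_right)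

lemma is_adjoint_self_form_real: "is_adjoint T T \<Longrightarrow> cinner v (T v) \<in> \<real>"
  by (metis Reals_cnj_iff cinner_commute is_adjoint_def)

text \<open>Polarization along \<open>x + y\<close> and \<open>x + \<i> y\<close>.\<close>

lemma real_form_is_adjoint_self:
  assumes T: "T \<in> bounded_ops" and real: "\<And>v. cinner v (T v) \<in> \<real>"
  shows "is_adjoint T T"
  unfolding is_adjoint_def
proof (intro allI)
  fix x y
  let ?f = "cinner x (T y)" and ?g = "cinner y (T x)"
  have im: "Im (cinner v (T v)) = 0" for v
    using real[of v] by (simp add: complex_is_Real_iff)
  \<comment> \<open>The diagonal terms of the form at x + y are real, so only the mixed terms
    remain: f and g have opposite imaginary parts.\<close>
  have "Im (?f + ?g) = 0"
    using im[of "x + y"] im[of x] im[of y]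
    by (simp add: blinfun.add_right cinner_add_left cinner_add_right)
  \<comment> \<open>Complex linearity comes from membership in \<open>bounded_ops\<close>, as the
    type only gives real linearity. The form at x + i y then shows that f and g have equal real
    parts.\<close>
  moreover have "T (\<i> *\<^sub>C y) = \<i> *\<^sub>C T y"
    using T by (simp add: bounded_ops_def)
  then have "Im (\<i> * ?f - \<i> * ?g) = 0"
    using im[of "x + \<i> *\<^sub>C y"] im[of x] im[of y]
    by (simp add: blinfun.add_right cinner_add_left cinner_add_right
        cinner_scaleC_left cinner_scaleC_right)
  ultimately have "?f = cnj ?g"
    by (intro complex_eqI) simp_all
  then show "cinner (T x) y = ?f"
    by (metis cinner_commute)
qed

text \<open>Collects what a channel and a conditional expectation have in common, so that the facts
  on adjoints serve both. Positivity is asked at level one only, which is what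
  \<open>conditional_expectation\<close> provides.\<close>

locale unital_positive_map =
  fixes N :: "('h \<Rightarrow>\<^sub>L 'h::complex_hilbert_space) set"
    and F :: "('h \<Rightarrow>\<^sub>L 'h) \<Rightarrow> ('h \<Rightarrow>\<^sub>L 'h)"
  assumes vna: "von_neumann_algebra N"
    and maps: "F \<in> N \<rightarrow> N"
    and lin: "linear_map_on N F"
    and unital: "F id_blinfun = id_blinfun"
    and pos: "\<And>x. x \<in> N \<Longrightarrow> positive_op x \<Longrightarrow> positive_op (F x)"
begin

lemma N_bounded: "N \<subseteq> bounded_ops"
  and N_id: "id_blinfun \<in> N"
  and N_add: "x \<in> N \<Longrightarrow> y \<in> N \<Longrightarrow> x + y \<in> N"
  and N_cscalar: "x \<in> N \<Longrightarrow> cscalar c o\<^sub>L x \<in> N"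
  using vna by (auto simp: von_neumann_algebra_def)

lemma N_scaleR: "x \<in> N \<Longrightarrow> r *\<^sub>R x \<in> N"
  by (metis N_cscalar cscalar_of_real)

lemma N_diff: "x \<in> N \<Longrightarrow> y \<in> N \<Longrightarrow> x - y \<in> N"
  using N_add[of x "(-1) *\<^sub>R y"] N_scaleR[of y "-1"] by simp

lemma N_zero: "0 \<in> N"
  using N_scaleR[OF N_id, of 0] by simp

lemma F_N: "x \<in> N \<Longrightarrow> F x \<in> N"
  using maps by auto

lemma F_add: "x \<in> N \<Longrightarrow> y \<in> N \<Longrightarrow> F (x + y) = F x + F y"
  and F_cscalar: "x \<in> N \<Longrightarrow> F (cscalar c o\<^sub>L x) = cscalar c o\<^sub>L F x"
  using lin by (auto simp: linear_map_on_def)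

lemma F_scaleR: "x \<in> N \<Longrightarrow> F (r *\<^sub>R x) = r *\<^sub>R F x"
  by (metis F_cscalar cscalar_of_real)

lemma F_diff: "x \<in> N \<Longrightarrow> y \<in> N \<Longrightarrow> F (x - y) = F x - F y"
  using F_add[of x "(-1) *\<^sub>R y"] F_scaleR[of y "-1"] N_scaleR[of y "-1"] by simp

lemma F_zero: "F 0 = 0"
  using F_scaleR[OF N_id, of 0] by simp

text \<open>By Cauchy-Schwarz, norm x + x is positive, hence so is its image. As F is unital, the
  image differs from F x by a real multiple of the identity, so the form of F x is real.\<close>

lemma F_selfadjoint:
  assumes x: "x \<in> N" "is_adjoint x x"
  shows "is_adjoint (F x) (F x)"
proof (rule real_form_is_adjoint_self)
  show "F x \<in> bounded_ops"
    using F_N[OF x(1)] N_bounded by auto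
  fix v
  let ?p = "norm x *\<^sub>R id_blinfun + x"
  have form: "cinner v ((r *\<^sub>R id_blinfun + T) v) = of_real (r * (norm v)\<^sup>2) + cinner v (T v)"
    for r T and v :: 'h
    by (simp add: blinfun.add_left blinfun.scaleR_left cinner_add_right cinner_scaleR_right
        cinner_self)
  have "positive_op ?p"
    unfolding positive_op_def form
  proof
    fix v
    have "\<bar>inner v (x v)\<bar> \<le> norm v * norm (x v)"
      by (rule Cauchy_Schwarz_ineq2)
    also have "\<dots> \<le> norm v * (norm x * norm v)"
      by (intro mult_left_mono norm_blinfun) simp
    finally have "0 \<le> norm x * (norm v)\<^sup>2 + inner v (x v)"
      by (simp add: power2_eq_square algebra_simps)
    then show "of_real (norm x * (norm v)\<^sup>2) + cinner v (x v) \<in> \<real> \<and>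
        0 \<le> Re (of_real (norm x * (norm v)\<^sup>2) + cinner v (x v))"
      using is_adjoint_self_form_real[OF x(2)]
      by (auto simp: inner_eq_Re_cinner intro: Reals_add Reals_of_real simp del: of_real_mult)
  qed
  then have "positive_op (F ?p)"
    by (intro pos N_add N_scaleR N_id x)
  moreover have "F ?p = norm x *\<^sub>R id_blinfun + F x"
    by (simp add: F_add F_scaleR N_scaleR N_id x unital)
  ultimately have "of_real (norm x * (norm v)\<^sup>2) + cinner v (F x v) \<in> \<real>"
    unfolding positive_op_def form[symmetric] by simp
  then show "cinner v (F x v) \<in> \<real>"
    by (simp add: complex_is_Real_iff)
qed

text \<open>Apply the selfadjoint case to \<open>x + y\<close> and \<open>\<i> (x - y)\<close>.\<close>

lemma F_is_adjoint:
  assumes x: "x \<in> N" and y: "y \<in> N" and adj: "is_adjoint x y"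
  shows "is_adjoint (F x) (F y)"
proof -
  note cs = blinfun.add_left blinfun.diff_left cinner_add_left cinner_add_right cinner_diff_left
    cinner_diff_right cinner_scaleC_left cinner_scaleC_right
  have adj': "cinner (x u) v = cinner u (y v)" "cinner (y u) v = cinner u (x v)" for u v
    using adj is_adjoint_sym[OF adj] by (auto simp: is_adjoint_def)
  have "is_adjoint (F (x + y)) (F (x + y))"
    by (intro F_selfadjoint N_add x y) (simp add: is_adjoint_def cs adj')
  then have p: "is_adjoint (F x + F y) (F x + F y)"
    by (simp add: F_add x y)
  have "is_adjoint (F (cscalar \<i> o\<^sub>L (x - y))) (F (cscalar \<i> o\<^sub>L (x - y)))"
    by (intro F_selfadjoint N_cscalar N_diff x y)
      (simp add: is_adjoint_def cs adj' algebra_simps)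
  then have m: "is_adjoint (cscalar \<i> o\<^sub>L (F x - F y)) (cscalar \<i> o\<^sub>L (F x - F y))"
    by (simp add: F_cscalar F_diff N_diff x y)
  show ?thesis
    unfolding is_adjoint_def
  proof (intro allI)
    fix u v
    have 1: "cinner (F x u) v + cinner (F y u) v = cinner u (F x v) + cinner u (F y v)"
      using p by (simp add: is_adjoint_def cs)
    \<comment> \<open>The form is antilinear in its first argument, so i leaves it as -i; this
      exchanges the two terms on the left.\<close>
    have "\<i> * (cinner (F y u) v - cinner (F x u) v) = \<i> * (cinner u (F x v) - cinner u (F y v))"
      using m by (simp add: is_adjoint_def cs algebra_simps)
    then have 2: "cinner (F y u) v - cinner (F x u) v = cinner u (F x v) - cinner u (F y v)"
      by simp
    show "cinner (F x u) v = cinner u (F y v)"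
      using arg_cong2[OF 1 2, of "(-)"] by simp
  qed
qed

text \<open>Off the diagonal the entries of a selfadjoint matrix are only adjoint to one another in
  pairs, so this rests on \<open>F_is_adjoint\<close> rather than on
  \<open>F_selfadjoint\<close>.\<close>

lemma amplify_selfadjoint:
  "x \<in> matrices n N \<Longrightarrow> mat_selfadjoint n x \<Longrightarrow> mat_selfadjoint n (amplify F x)"
  by (auto simp: mat_selfadjoint_def amplify_def matrices_def intro: F_is_adjoint)

end


section \<open>Operator matrices\<close>

text \<open>Gives access to the Minkowski and Cauchy-Schwarz inequalities for
  \<open>L2_set\<close>.\<close>

lemma vec_norm_L2_set: "vec_norm n v = L2_set (\<lambda>i. norm (v i)) {..<n}"
  by (simp add: vec_norm_def L2_set_def)

lemma vec_norm_nonneg [simp]: "0 \<le> vec_norm n v"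
  by (simp add: vec_norm_L2_set L2_set_nonneg)

lemma vec_norm_cong: "(\<And>i. i < n \<Longrightarrow> v i = w i) \<Longrightarrow> vec_norm n v = vec_norm n w"
  by (simp add: vec_norm_def)

text \<open>Vectors are functions on all naturals, so \<open>vec_norm n\<close> is only a seminorm.
  Degenerate cases below are therefore split by norm zero and not by v = 0.\<close>

lemma vec_norm_eq_0: "vec_norm n v = 0 \<longleftrightarrow> (\<forall>i<n. v i = 0)"
  by (auto simp: vec_norm_L2_set L2_set_eq_0_iff)

lemma vec_norm_diff: "vec_norm n (\<lambda>i. v i - w i) \<le> vec_norm n v + vec_norm n w"
proof -
  have "vec_norm n (\<lambda>i. v i - w i) \<le> L2_set (\<lambda>i. norm (v i) + norm (w i)) {..<n}"
    unfolding vec_norm_L2_set by (intro L2_set_mono norm_triangle_ineq4 norm_ge_zero)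
  also have "\<dots> \<le> vec_norm n v + vec_norm n w"
    unfolding vec_norm_L2_set by (rule L2_set_triangle_ineq)
  finally show ?thesis .
qed

lemma vec_norm_scaleR: "vec_norm n (\<lambda>i. r *\<^sub>R v i) = \<bar>r\<bar> * vec_norm n v"
  by (simp add: vec_norm_L2_set L2_set_right_distrib)

lemma vec_norm_blinfun: "vec_norm n (\<lambda>i. blinfun_apply s (v i)) \<le> norm s * vec_norm n v"
  unfolding vec_norm_L2_set L2_set_right_distrib[OF norm_ge_zero]
  by (intro L2_set_mono norm_blinfun norm_ge_zero)

lemma vec_norm_sq: "(vec_norm n v)\<^sup>2 = (\<Sum>i<n. (norm (v i))\<^sup>2)"
  by (simp add: vec_norm_def sum_nonneg)

lemma vec_cinner_self: "vec_cinner n v v = of_real ((vec_norm n v)\<^sup>2)"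
  by (simp add: vec_cinner_def cinner_self vec_norm_sq)

lemma Re_vec_cinner: "Re (vec_cinner n v w) = (\<Sum>i<n. inner (v i) (w i))"
  by (simp add: vec_cinner_def inner_eq_Re_cinner)

lemma Re_vec_cinner_le: "\<bar>Re (vec_cinner n v w)\<bar> \<le> vec_norm n v * vec_norm n w"
proof -
  have "\<bar>Re (vec_cinner n v w)\<bar> \<le> (\<Sum>i<n. \<bar>norm (v i)\<bar> * \<bar>norm (w i)\<bar>)"
    unfolding Re_vec_cinner
    by (rule order_trans[OF sum_abs]) (intro sum_mono, simp add: Cauchy_Schwarz_ineq2)
  also have "\<dots> \<le> vec_norm n v * vec_norm n w"
    unfolding vec_norm_L2_set by (rule L2_set_mult_ineq)
  finally show ?thesis .
qed

lemma vec_norm_parallelogram: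
  "(vec_norm n (\<lambda>i. v i + w i))\<^sup>2 + (vec_norm n (\<lambda>i. v i - w i))\<^sup>2
     = 2 * (vec_norm n v)\<^sup>2 + 2 * (vec_norm n w)\<^sup>2"
  unfolding vec_norm_sq sum_distrib_left sum.distrib[symmetric]
  by (rule sum.cong)
    (simp_all add: power2_norm_eq_inner inner_add_left inner_add_right inner_diff_left
      inner_diff_right inner_commute)

section \<open>The action of operator matrices and their norm\<close>

lemma mat_apply_add: "mat_apply n x (\<lambda>i. v i + w i) i = mat_apply n x v i + mat_apply n x w i"
  by (simp add: mat_apply_def blinfun.add_right sum.distrib)

lemma mat_apply_diff: "mat_apply n x (\<lambda>i. v i - w i) i = mat_apply n x v i - mat_apply n x w i"
  by (simp add: mat_apply_def blinfun.diff_right sum_subtractf)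

lemma mat_apply_scaleR: "mat_apply n x (\<lambda>i. r *\<^sub>R v i) i = r *\<^sub>R mat_apply n x v i"
  by (simp add: mat_apply_def blinfun.scaleR_right scaleR_sum_right)

lemma vec_norm_mat_apply_eq_0: "vec_norm n v = 0 \<Longrightarrow> vec_norm n (mat_apply n x v) = 0"
  by (auto simp: vec_norm_eq_0 mat_apply_def)

lemma mat_norm_apply_le:
  "ennreal (vec_norm n (mat_apply n x v)) \<le> mat_norm n x * ennreal (vec_norm n v)"
proof (cases "vec_norm n v = 0")
  \<comment> \<open>Here the right side is 0 even for infinite \<open>mat_norm\<close>, so the left
    side has to vanish; it does because \<open>mat_apply n\<close> reads v only below n.\<close>
  case True
  then show ?thesis by (simp add: vec_norm_mat_apply_eq_0)
next
  case False
  let ?r = "vec_norm n v" and ?w = "\<lambda>i. inverse (vec_norm n v) *\<^sub>R v i"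
  have r: "?r > 0"
    using False vec_norm_nonneg[of n v] by linarith
  have "vec_norm n ?w \<le> 1"
    using r by (simp add: vec_norm_scaleR)
  then have "ennreal (vec_norm n (mat_apply n x ?w)) \<le> mat_norm n x"
    unfolding mat_norm_def by (intro SUP_upper) simp
  then have "ennreal (vec_norm n (mat_apply n x ?w)) * ennreal ?r \<le> mat_norm n x * ennreal ?r"
    by (rule mult_right_mono) simp
  moreover have "vec_norm n (mat_apply n x ?w) * ?r = vec_norm n (mat_apply n x v)"
    using r by (simp add: mat_apply_scaleR[abs_def] vec_norm_scaleR)
  ultimately show ?thesis
    by (simp add: ennreal_mult'[symmetric])
qed

lemma mat_norm_leI:
  assumes "\<And>v. vec_norm n (mat_apply n x v) \<le> c * vec_norm n v" "0 \<le> c"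
  shows "mat_norm n x \<le> ennreal c"
  unfolding mat_norm_def
proof (rule SUP_least)
  fix v :: "nat \<Rightarrow> 'a" assume "v \<in> {v. vec_norm n v \<le> 1}"
  then have "c * vec_norm n v \<le> c"
    using assms(2) by (simp add: mult_left_le)
  then show "ennreal (vec_norm n (mat_apply n x v)) \<le> ennreal c"
    using assms(1)[of v] by (intro ennreal_leI) linarith
qed

section \<open>Selfadjoint matrices and their quadratic forms\<close>

lemma mat_selfadjoint_form:
  assumes "mat_selfadjoint n x"
  shows "vec_cinner n v (mat_apply n x w) = cnj (vec_cinner n w (mat_apply n x v))"
proof -
  have "cnj (vec_cinner n w (mat_apply n x v)) = (\<Sum>i<n. \<Sum>j<n. cnj (cinner (w i) (x i j (v j))))"
    by (simp add: vec_cinner_def mat_apply_def cinner_sum_right)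
  also have "\<dots> = (\<Sum>i<n. \<Sum>j<n. cinner (v j) (x j i (w i)))"
  proof (intro sum.cong refl)
    fix i j assume "i \<in> {..<n}" "j \<in> {..<n}"
    then have "is_adjoint (x i j) (x j i)"
      using assms by (simp add: mat_selfadjoint_def)
    then show "cnj (cinner (w i) (x i j (v j))) = cinner (v j) (x j i (w i))"
      by (metis cinner_commute is_adjoint_def)
  qed
  also have "\<dots> = vec_cinner n v (mat_apply n x w)"
    unfolding vec_cinner_def mat_apply_def cinner_sum_right by (rule sum.swap)
  finally show ?thesis by simp
qed

text \<open>The numerical radius of a selfadjoint matrix dominates its norm: polarize
  \<open>\<langle>v, x w\<rangle>\<close> at the multiple \<open>v\<close> of \<open>x w\<close> that has the norm of \<open>w\<close>.\<close>

lemma mat_selfadjoint_norm_le: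
  assumes sa: "mat_selfadjoint n x"
    and bound: "\<And>v. \<bar>Re (vec_cinner n v (mat_apply n x v))\<bar> \<le> c * (vec_norm n v)\<^sup>2"
  shows "vec_norm n (mat_apply n x w) \<le> c * vec_norm n w"
proof (cases "vec_norm n w = 0 \<or> vec_norm n (mat_apply n x w) = 0")
  case True
  \<comment> \<open>No sign of c is assumed: the bound at w itself forces c to be nonnegative once w
    has nonzero norm.\<close>
  have "0 \<le> c * vec_norm n w"
  proof (cases "vec_norm n w = 0")
    case False
    then have "0 < vec_norm n w"
      using vec_norm_nonneg[of n w] by linarith
    moreover have "0 \<le> (c * vec_norm n w) * vec_norm n w"
      using order_trans[OF abs_ge_zero bound[of w]] by (simp add: power2_eq_square mult.assoc)
    ultimately show ?thesis
      by (simp add: zero_le_mult_iff)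
  qed simp
  then show ?thesis
    using True vec_norm_mat_apply_eq_0[of n w x] by auto
next
  case False
  let ?l = "vec_norm n w" and ?a = "vec_norm n (mat_apply n x w)"
  have l: "?l > 0" and a: "?a > 0"
    using False vec_norm_nonneg[of n w] vec_norm_nonneg[of n "mat_apply n x w"] by linarith+
  define v where "v = (\<lambda>i. (?l / ?a) *\<^sub>R mat_apply n x w i)"
  let ?p = "\<lambda>i. v i + w i" and ?m = "\<lambda>i. v i - w i"
  define B where "B = (\<lambda>u u'. Re (vec_cinner n u (mat_apply n x u')))"
  have v: "vec_norm n v = ?l"
    using a l by (simp add: v_def vec_norm_scaleR)
  have "B v w = (?l / ?a) * (\<Sum>i<n. inner (mat_apply n x w i) (mat_apply n x w i))"
    by (simp add: B_def Re_vec_cinner v_def sum_distrib_left)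
  also have "\<dots> = (?l / ?a) * ?a\<^sup>2"
    by (simp add: vec_norm_sq power2_norm_eq_inner)
  also have "\<dots> = ?l * ?a"
    using a by (simp add: power2_eq_square)
  finally have vw: "B v w = ?l * ?a" .
  \<comment> \<open>Selfadjointness makes the two mixed terms complex conjugates, so polarization of
    the real part needs only v + w and v - w.\<close>
  have "B w v = B v w"
    unfolding B_def by (subst mat_selfadjoint_form[OF sa]) simp
  moreover have "B ?p ?p - B ?m ?m = 2 * B v w + 2 * B w v"
    by (simp add: B_def Re_vec_cinner mat_apply_add mat_apply_diff inner_add_left inner_add_right
        inner_diff_left inner_diff_right sum.distrib sum_subtractf)
  ultimately have "4 * B v w = B ?p ?p - B ?m ?m"
    by simp
  \<comment> \<open>Since v and w both have norm l, the parallelogram law turns the bracket into 4 l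
    squared, which cancels the 4 on the left.\<close>
  also have "\<dots> \<le> c * ((vec_norm n ?p)\<^sup>2 + (vec_norm n ?m)\<^sup>2)"
    using bound[of ?p] bound[of ?m] by (simp add: B_def distrib_left)
  also have "\<dots> = ?l * (4 * (c * ?l))"
    unfolding vec_norm_parallelogram v by (simp add: power2_eq_square)
  finally have "?l * ?a \<le> ?l * (c * ?l)"
    by (simp add: vw)
  then show ?thesis
    using l by simp
qed

section \<open>Commutators with diagonal matrices\<close>

lemma mat_commutator_diag:
  assumes "i < n" "j < n"
  shows "mat_commutator n (mat_diag s) x i j = (s o\<^sub>L x i j) - (x i j o\<^sub>L s)"
proof -
  have "(\<Sum>k<n. mat_diag s i k o\<^sub>L x k j) = (\<Sum>k<n. if i = k then s o\<^sub>L x k j else 0)"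
    by (rule sum.cong) (auto simp: mat_diag_def)
  then have left: "(\<Sum>k<n. mat_diag s i k o\<^sub>L x k j) = s o\<^sub>L x i j"
    using assms by simp
  have "(\<Sum>k<n. x i k o\<^sub>L mat_diag s k j) = (\<Sum>k<n. if k = j then x i k o\<^sub>L s else 0)"
    by (rule sum.cong) (auto simp: mat_diag_def)
  then have right: "(\<Sum>k<n. x i k o\<^sub>L mat_diag s k j) = x i j o\<^sub>L s"
    using assms by simp
  show ?thesis
    unfolding mat_commutator_def mat_mult_def left right ..
qed

text \<open>Entry formulas such as \<open>mat_commutator_diag\<close> hold only for indices below n;
  the norm looks at no others, so they suffice for rewriting inside it.\<close>

lemma mat_norm_cong:
  assumes "\<And>i j. i < n \<Longrightarrow> j < n \<Longrightarrow> x i j = y i j"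
  shows "mat_norm n x = mat_norm n y"
  unfolding mat_norm_def
  by (intro SUP_cong refl arg_cong[where f = ennreal] vec_norm_cong)
    (simp add: mat_apply_def assms)

text \<open>The commutator sends v to s (x v) - x (s v), and each of the two terms contributes norm
  s times the norm of x. This is the origin of the factor 2.\<close>

lemma mat_norm_commutator_diag_le:
  "mat_norm n (mat_commutator n (mat_diag s) x) \<le> 2 * ennreal (norm s) * mat_norm n x"
proof -
  have "ennreal (vec_norm n (mat_apply n (mat_commutator n (mat_diag s) x) v))
      \<le> 2 * ennreal (norm s) * mat_norm n x" if v: "vec_norm n v \<le> 1" for v
  proof -
    have "vec_norm n (mat_apply n (mat_commutator n (mat_diag s) x) v)
        = vec_norm n (\<lambda>i. s (mat_apply n x v i) - mat_apply n x (\<lambda>j. s (v j)) i)"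
      by (rule vec_norm_cong)
        (simp add: mat_apply_def mat_commutator_diag blinfun.diff_left sum_subtractf
          blinfun.sum_right)
    also have "\<dots> \<le> norm s * vec_norm n (mat_apply n x v)
        + vec_norm n (mat_apply n x (\<lambda>j. s (v j)))"
      by (rule order_trans[OF vec_norm_diff]) (intro add_right_mono vec_norm_blinfun)
    finally have "ennreal (vec_norm n (mat_apply n (mat_commutator n (mat_diag s) x) v))
        \<le> ennreal (norm s) * ennreal (vec_norm n (mat_apply n x v))
          + ennreal (vec_norm n (mat_apply n x (\<lambda>j. s (v j))))"
      by (subst ennreal_mult'[symmetric], simp) (simp add: ennreal_plus[symmetric]
          ennreal_leI del: ennreal_plus)
    also have "\<dots> \<le> ennreal (norm s) * (mat_norm n x * ennreal 1)
        + mat_norm n x * ennreal (norm s)"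
    proof (intro add_mono mult_left_mono)
      show "ennreal (vec_norm n (mat_apply n x v)) \<le> mat_norm n x * ennreal 1"
        using v by (intro order_trans[OF mat_norm_apply_le] mult_left_mono ennreal_leI) auto
      have "vec_norm n (\<lambda>j. s (v j)) \<le> norm s"
        using order_trans[OF vec_norm_blinfun[of n s v] mult_left_le[OF v norm_ge_zero]] .
      then show "ennreal (vec_norm n (mat_apply n x (\<lambda>j. s (v j)))) \<le> mat_norm n x * ennreal (norm s)"
        by (intro order_trans[OF mat_norm_apply_le] mult_left_mono ennreal_leI) auto
    qed simp
    also have "\<dots> = 2 * ennreal (norm s) * mat_norm n x"
      by (simp add: mult_2[symmetric] mult_ac)
    finally show ?thesis .
  qed
  then show ?thesis
    unfolding mat_norm_def[of n "mat_commutator n (mat_diag s) x"] by (intro SUP_least) simp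
qed


section \<open>Contractivity of channels\<close>

text \<open>Positivity is complete positivity at n = 1. A constant function can stand for the 1 by 1
  matrix because only the entry at (0, 0) is read.\<close>

lemma channel_unital_positive_map:
  assumes vna: "von_neumann_algebra N" and ch: "channel N \<Phi>"
  shows "unital_positive_map N \<Phi>"
proof
  fix x assume x: "x \<in> N" "positive_op x"
  have mat: "mat_positive 1 (\<lambda>_ _. T) \<longleftrightarrow> positive_op T" for T :: "'a \<Rightarrow>\<^sub>L 'a"
  proof
    assume *: "mat_positive 1 (\<lambda>_ _. T)"
    show "positive_op T"
      unfolding positive_op_def
    proof
      fix v
      show "cinner v (T v) \<in> \<real> \<and> 0 \<le> Re (cinner v (T v))"
        using *[unfolded mat_positive_def, rule_format, of "\<lambda>_. v"]
        by (simp add: vec_cinner_def mat_apply_def)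
    qed
  qed (simp add: mat_positive_def positive_op_def vec_cinner_def mat_apply_def)
  have "(\<lambda>_ _. x) \<in> matrices 1 N" "mat_positive 1 (\<lambda>_ _. x)"
    using x mat by (simp_all add: matrices_def)
  then have "mat_positive 1 (amplify \<Phi> (\<lambda>_ _. x))"
    using ch by (simp add: channel_def completely_positive_on_def)
  then show "positive_op (\<Phi> x)"
    using mat by (simp add: amplify_def del: One_nat_def)
qed (use assms in \<open>auto simp: channel_def\<close>)

text \<open>Used with \<sigma> = 1 and \<sigma> = -1, where positivity of the two shifted matrices
  encodes a two-sided bound by c on the form of x. It serves both before and after the channel is
  applied.\<close>

lemma shifted_form:
  "vec_cinner n v (mat_apply n (\<lambda>i j. mat_diag (c *\<^sub>R id_blinfun) i j + \<sigma> *\<^sub>R x i j) v)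
     = of_real (c * (vec_norm n v)\<^sup>2) + of_real \<sigma> * vec_cinner n v (mat_apply n x v)"
proof -
  have "mat_apply n (\<lambda>i j. mat_diag (c *\<^sub>R id_blinfun) i j + \<sigma> *\<^sub>R x i j) v i
      = c *\<^sub>R v i + \<sigma> *\<^sub>R mat_apply n x v i" if "i < n" for i
  proof -
    have "(\<Sum>j<n. mat_diag (c *\<^sub>R id_blinfun) i j (v j)) = (\<Sum>j<n. if i = j then c *\<^sub>R v j else 0)"
      by (rule sum.cong) (auto simp: mat_diag_def blinfun.scaleR_left)
    then show ?thesis
      using that by (simp add: mat_apply_def blinfun.add_left blinfun.scaleR_left sum.distrib
          scaleR_sum_right)
  qed
  then have "vec_cinner n v (mat_apply n (\<lambda>i j. mat_diag (c *\<^sub>R id_blinfun) i j + \<sigma> *\<^sub>R x i j) v)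
      = of_real c * vec_cinner n v v + of_real \<sigma> * vec_cinner n v (mat_apply n x v)"
    by (simp add: vec_cinner_def cinner_add_right cinner_scaleR_right sum.distrib sum_distrib_left)
  then show ?thesis
    by (simp add: vec_cinner_self)
qed

lemma channel_contractive:
  assumes vna: "von_neumann_algebra N" and ch: "channel N \<Phi>" and n: "1 \<le> n"
    and y: "y \<in> matrices n N" "mat_selfadjoint n y"
  shows "mat_norm n (amplify \<Phi> y) \<le> mat_norm n y"
proof (cases "mat_norm n y")
  \<comment> \<open>c is the norm of y. In the remaining case that norm is infinite and the claim is
    trivial.\<close>
  case (real c)
  interpret unital_positive_map N \<Phi>
    using vna ch by (rule channel_unital_positive_map)
  have y_le: "vec_norm n (mat_apply n y v) \<le> c * vec_norm n v" for v
    using mat_norm_apply_le[of n y v] real by (simp add: ennreal_mult'[symmetric])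
  have form_le: "\<bar>Re (vec_cinner n v (mat_apply n y v))\<bar> \<le> c * (vec_norm n v)\<^sup>2" for v
  proof -
    have "\<bar>Re (vec_cinner n v (mat_apply n y v))\<bar> \<le> vec_norm n v * vec_norm n (mat_apply n y v)"
      by (rule Re_vec_cinner_le)
    also have "\<dots> \<le> vec_norm n v * (c * vec_norm n v)"
      by (intro mult_left_mono y_le) simp
    finally show ?thesis
      by (simp add: power2_eq_square algebra_simps)
  qed
  have form_real: "vec_cinner n v (mat_apply n y v) \<in> \<real>" for v
    using mat_selfadjoint_form[OF y(2), of v v] by (simp add: Reals_cnj_iff)
  have \<Phi>_form: "0 \<le> c * (vec_norm n v)\<^sup>2 + \<sigma> * Re (vec_cinner n v (mat_apply n (amplify \<Phi> y) v))"
    if \<sigma>: "\<sigma> = 1 \<or> \<sigma> = -1" for \<sigma> v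
  proof -
    let ?P = "\<lambda>z i j. mat_diag (c *\<^sub>R id_blinfun) i j + \<sigma> *\<^sub>R z i j"
    have diag: "mat_diag (c *\<^sub>R id_blinfun) i j \<in> N" for i j
      by (simp add: mat_diag_def N_scaleR N_id N_zero)
    have "?P y \<in> matrices n N"
      using y(1) by (simp add: matrices_def N_add N_scaleR diag)
    moreover have "mat_positive n (?P y)"
      unfolding mat_positive_def shifted_form
    proof (intro allI conjI)
      fix v
      show "of_real (c * (vec_norm n v)\<^sup>2) + of_real \<sigma> * vec_cinner n v (mat_apply n y v) \<in> \<real>"
        by (intro Reals_add Reals_mult form_real Reals_of_real)
      show "0 \<le> Re (of_real (c * (vec_norm n v)\<^sup>2) + of_real \<sigma> * vec_cinner n v (mat_apply n y v))"
        using \<sigma> form_le[of v] by auto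
    qed
    ultimately have pos: "mat_positive n (amplify \<Phi> (?P y))"
      using ch n by (simp add: channel_def completely_positive_on_def)
    have "mat_apply n (amplify \<Phi> (?P y)) v i = mat_apply n (?P (amplify \<Phi> y)) v i"
      if "i < n" for i
    proof -
      \<comment> \<open>The scalar matrix is fixed entrywise: on the diagonal because \<Phi> is
        unital, off it because \<Phi> maps 0 to 0.\<close>
      have "\<Phi> (?P y i j) = ?P (amplify \<Phi> y) i j" if "j < n" for j
        using y(1) \<open>i < n\<close> that
        by (simp add: matrices_def amplify_def F_add F_scaleR diag N_scaleR)
          (simp add: mat_diag_def F_scaleR N_id unital F_zero)
      then show ?thesis
        by (simp add: mat_apply_def amplify_def)
    qed
    then have "vec_cinner n v (mat_apply n (amplify \<Phi> (?P y)) v)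
        = vec_cinner n v (mat_apply n (?P (amplify \<Phi> y)) v)"
      by (simp add: vec_cinner_def)
    with pos have "0 \<le> Re (vec_cinner n v (mat_apply n (?P (amplify \<Phi> y)) v))"
      unfolding mat_positive_def by (elim allE[of _ v]) simp
    then show ?thesis
      by (simp add: shifted_form)
  qed
  \<comment> \<open>The two signs give the lower and the upper bound. Selfadjointness of the image
    then turns this bound on the form into one on the norm.\<close>
  have "\<bar>Re (vec_cinner n v (mat_apply n (amplify \<Phi> y) v))\<bar> \<le> c * (vec_norm n v)\<^sup>2" for v
    using \<Phi>_form[of 1 v] \<Phi>_form[of "-1" v] by simp
  then have "vec_norm n (mat_apply n (amplify \<Phi> y) v) \<le> c * vec_norm n v" for v
    by (intro mat_selfadjoint_norm_le amplify_selfadjoint y)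
  then show ?thesis
    using real by (simp add: mat_norm_leI)
qed simp

text \<open>The argument stays at one matrix size n throughout, so a single statement yields both
  the plain bound (n = 1) and the completely bounded one (supremum over n).\<close>

lemma Lip_level_le_Cost_level:
  assumes vna: "von_neumann_algebra N"
    and E: "conditional_expectation N (commutant S \<inter> N) E"
    and ch: "channel N \<Phi>"
    and fixed: "\<forall>x\<in>N. \<Phi> (E x) = E x"
    and n: "1 \<le> n"
  shows "Lip_level n S N \<Phi> \<le> 2 * (SUP s\<in>S. ennreal (norm s)) * Cost_level n S N E"
proof -
  interpret \<Phi>: unital_positive_map N \<Phi>
    using vna ch by (rule channel_unital_positive_map)
  have E_mem: "E x \<in> commutant S" "E x \<in> N" if "x \<in> N" for x
    using E that by (auto simp: conditional_expectation_def)
  \<comment> \<open>\<open>conditional_expectation\<close> does not list unitality; it follows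
    because the identity lies in the fixed algebra, on which E acts as the identity map.\<close>
  have "id_blinfun \<in> commutant S \<inter> N"
    using \<Phi>.N_id by (auto simp: commutant_def bounded_ops_def intro: blinfun_eqI)
  then have "E id_blinfun = id_blinfun"
    using E by (auto simp: conditional_expectation_def)
  then interpret E: unital_positive_map N E
    using E vna by unfold_locales (auto simp: conditional_expectation_def)
  have "mat_norm n (mat_commutator n (mat_diag s) (amplify \<Phi> x))
      \<le> 2 * (SUP s\<in>S. ennreal (norm s)) * Cost_level n S N E"
    if x: "x \<in> lip_ball n S N" and s: "s \<in> S" for x s
  proof -
    have xN: "x i j \<in> N" if "i < n" "j < n" for i j
      using x that by (simp add: lip_ball_def matrices_def)
    have x': "x \<in> matrices n N" "mat_selfadjoint n x"
      using x by (simp_all add: lip_ball_def)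
    \<comment> \<open>The order E x - x is that of \<open>Cost_level\<close>. Applying \<Phi> gives
      E x - \<Phi> x, whence the minus sign in the commutator identity below.\<close>
    let ?d = "\<lambda>i j. amplify E x i j - x i j"
    have d: "?d \<in> matrices n N" "mat_selfadjoint n ?d"
      using xN x'(2) E.amplify_selfadjoint[OF x']
      by (auto simp: matrices_def amplify_def mat_selfadjoint_def \<Phi>.N_diff E_mem
          intro: is_adjoint_diff)
    have "mat_commutator n (mat_diag s) (amplify \<Phi> x) i j
        = - mat_commutator n (mat_diag s) (amplify \<Phi> ?d) i j" if "i < n" "j < n" for i j
    proof -
      have "s o\<^sub>L E (x i j) = E (x i j) o\<^sub>L s"
        using E_mem(1)[OF xN[OF that]] s by (simp add: commutant_def)
      moreover have "amplify \<Phi> ?d i j = E (x i j) - \<Phi> (x i j)"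
        using xN[OF that] fixed by (simp add: amplify_def \<Phi>.F_diff E_mem)
      ultimately show ?thesis
        using that
        by (simp add: mat_commutator_diag amplify_def bounded_bilinear.diff_left
            bounded_bilinear.diff_right bounded_bilinear_blinfun_compose)
    qed
    then have "mat_norm n (mat_commutator n (mat_diag s) (amplify \<Phi> x))
        = mat_norm n (\<lambda>i j. - mat_commutator n (mat_diag s) (amplify \<Phi> ?d) i j)"
      by (rule mat_norm_cong)
    also have "\<dots> = mat_norm n (mat_commutator n (mat_diag s) (amplify \<Phi> ?d))"
      by (simp add: mat_norm_def mat_apply_def blinfun.minus_left sum_negf vec_norm_def)
    also have "\<dots> \<le> 2 * ennreal (norm s) * mat_norm n (amplify \<Phi> ?d)"
      by (rule mat_norm_commutator_diag_le)
    \<comment> \<open>\<open>channel_contractive\<close> covers selfadjoint matrices only, which is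
      why selfadjointness of \<open>?d\<close> was established above.\<close>
    also have "\<dots> \<le> 2 * ennreal (norm s) * mat_norm n ?d"
      by (intro mult_left_mono channel_contractive[OF vna ch n] d) simp
    \<comment> \<open>The norm of \<open>?d\<close> is one of the values whose supremum is
      \<open>Cost_level\<close>, because x lies in the Lipschitz ball.\<close>
    also have "\<dots> \<le> 2 * (SUP s\<in>S. ennreal (norm s)) * Cost_level n S N E"
      unfolding Cost_level_def by (intro mult_mono SUP_upper order_refl s x) simp_all
    finally show ?thesis .
  qed
  then show ?thesis
    unfolding Lip_level_def lip_seminorm_def by (intro SUP_least)
qed

theorem proposition3p12:
  fixes N S :: "('h \<Rightarrow>\<^sub>L 'h::complex_hilbert_space) set"
    and E \<Phi> :: "('h \<Rightarrow>\<^sub>L 'h) \<Rightarrow> ('h \<Rightarrow>\<^sub>L 'h)"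
  assumes "von_neumann_algebra N"
    and "S \<subseteq> bounded_ops" and "finite S"
    and "von_neumann_algebra (commutant S)"
    and "conditional_expectation N (commutant S \<inter> N) E"
    and "normal_map N (commutant S \<inter> N) E"
    and "channel N \<Phi>"
    and "\<forall>x\<in>N. \<Phi> (E x) = E x"
  shows "Lip S N \<Phi> \<le> 2 * (SUP s\<in>S. ennreal (norm s)) * Cost S N E \<and>
         Lip_cb S N \<Phi> \<le> 2 * (SUP s\<in>S. ennreal (norm s)) * Cost_cb S N E"
proof
  note level = Lip_level_le_Cost_level[OF assms(1,5,7,8)]
  show "Lip S N \<Phi> \<le> 2 * (SUP s\<in>S. ennreal (norm s)) * Cost S N E"
    unfolding Lip_def Cost_def by (rule level) simp
  show "Lip_cb S N \<Phi> \<le> 2 * (SUP s\<in>S. ennreal (norm s)) * Cost_cb S N E"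
    unfolding Lip_cb_def Cost_cb_def
  \<comment> \<open>The factor in front of the cost is the same for every n, so the bounds at each
    level pass to the supremum.\<close>
  proof (rule SUP_least)
    fix n :: nat assume n: "n \<in> {1..}"
    have "Lip_level n S N \<Phi> \<le> 2 * (SUP s\<in>S. ennreal (norm s)) * Cost_level n S N E"
      using n by (intro level) simp
    also have "\<dots> \<le> 2 * (SUP s\<in>S. ennreal (norm s)) * (SUP n\<in>{1..}. Cost_level n S N E)"
      using n by (intro mult_left_mono SUP_upper) simp_all
    finally show "Lip_level n S N \<Phi>
        \<le> 2 * (SUP s\<in>S. ennreal (norm s)) * (SUP n\<in>{1..}. Cost_level n S N E)" .
  qed
qed

end
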